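(* Let $G$ be a countable group with abelian rank $r(G)=\infty$. Then $G$ does not possess Tempel'man sequences, and every tempered sequence in $G$ grows super-exponentially.
   Context: For subsets $A,B$ of a group $G$, write $AB=\{ab : a\in A,\ b\in B\}$ and $A^{-1}=\{a^{-1}: a\in A\}$; $|A|$ is the cardinality of $A$. A Følner sequence in a countable group $G$ is a sequence $\{F_n\}_{n\ge 1}$ of finite non-empty subsets of $G$ such that $\frac{1}{|F_n|}|gF_n\cap F_n|\to 1$ as $n\to\infty$ for every $g\in G$. A Tempel'man sequence in $G$ is a Følner sequence $\{F_n\}$ in $G$ that is increasing ($F_n\subseteq F_{n+1}$ for all $n$) and for which there is a constant $C$ such that $|F_n^{-1}F_n|\le C|F_n|$ for every $n$. A tempered sequence in $G$ is a Følner sequence $\{F_n\}$ in $G$ for which there is a constant $C$ such that $\left|\left(\bigcup_{i<n}F_i^{-1}\right)F_n\right|\le C|F_n|$ for every $n$. A sequence $\{F_n\}$ of finite sets grows super-exponentially if for every real $c>1$ one has $|F_n|\ge c^n$ for all sufficiently large $n$. The abelian rank of $G$ is $r(G)=\sup\{n : G \text{ contains a subgroup isomorphic to } \mathbb{Z}^n\}\in\{0,1,2,\dots\}\cup\{\infty\}$. *)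

theory Defs
  imports
    Complex_Main
    "HOL-Library.Countable_Set"
    "HOL-Library.Extended_Nat"
    "HOL-Algebra.Product_Groups"
    "HOL-Algebra.Elementary_Groups"
begin

text \<open>A sequence \<open>(F\<^sub>n)\<close> with \<open>n \<ge> 1\<close> is a function on \<^typ>\<open>nat\<close> whose value at \<open>0\<close> is
  unconstrained.\<close>

definition folner_sequence :: "('a, 'b) monoid_scheme \<Rightarrow> (nat \<Rightarrow> 'a set) \<Rightarrow> bool" where
  "folner_sequence G F \<longleftrightarrow>
     (\<forall>n\<ge>1. F n \<subseteq> carrier G \<and> finite (F n) \<and> F n \<noteq> {}) \<and>
     (\<forall>g\<in>carrier G.
        (\<lambda>n. real (card ((g <#\<^bsub>G\<^esub> F n) \<inter> F n)) / real (card (F n))) \<longlonglongrightarrow> 1)"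

definition tempelman_sequence :: "('a, 'b) monoid_scheme \<Rightarrow> (nat \<Rightarrow> 'a set) \<Rightarrow> bool" where
  "tempelman_sequence G F \<longleftrightarrow>
     folner_sequence G F \<and>
     (\<forall>n\<ge>1. F n \<subseteq> F (Suc n)) \<and>
     (\<exists>C::real. \<forall>n\<ge>1.
        real (card ((set_inv\<^bsub>G\<^esub> (F n)) <#>\<^bsub>G\<^esub> F n)) \<le> C * real (card (F n)))"

definition tempered_sequence :: "('a, 'b) monoid_scheme \<Rightarrow> (nat \<Rightarrow> 'a set) \<Rightarrow> bool" where
  "tempered_sequence G F \<longleftrightarrow>
     folner_sequence G F \<and>
     (\<exists>C::real. \<forall>n\<ge>1.
        real (card ((\<Union>i\<in>{1..<n}. set_inv\<^bsub>G\<^esub> (F i)) <#>\<^bsub>G\<^esub> F n)) \<le> C * real (card (F n)))"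

definition grows_super_exponentially :: "(nat \<Rightarrow> 'a set) \<Rightarrow> bool" where
  "grows_super_exponentially F \<longleftrightarrow>
     (\<forall>c::real. c > 1 \<longrightarrow> (\<forall>\<^sub>F n in sequentially. real (card (F n)) \<ge> c ^ n))"

definition int_power_group :: "nat \<Rightarrow> (nat \<Rightarrow> int) monoid" where
  "int_power_group n = product_group {..<n} (\<lambda>_. integer_group)"

definition abelian_rank :: "('a, 'b) monoid_scheme \<Rightarrow> enat" where
  "abelian_rank G =
     Sup {enat n | n. \<exists>H. subgroup H G \<and> G\<lparr>carrier := H\<rparr> \<cong> int_power_group n}"

end

theory Submission
  imports Defs "HOL-Analysis.Henstock_Kurzweil_Integration"
begin

text \<open>
  The reason for the theorem is that products \<open>X\<^sup>-\<^sup>1 Y\<close> are large in high rank, as in the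
  Brunn--Minkowski inequality: in \<open>\<int>\<^sup>n\<close>, for finite \<open>A\<close> and \<open>B\<close>, the sumset \<open>A + B + {0, 1}\<^sup>n\<close> has at
  least \<open>2 ^ n\<close> times the geometric mean of \<open>card A\<close> and \<open>card B\<close> elements. This follows by induction
  on \<open>n\<close> from a one-dimensional Prekopa--Leindler inequality (\<open>prekopa_leindler_int\<close>,
  \<open>expanding_DirProd_integer_group\<close>).

  If \<open>G\<close> contains a copy \<open>H\<close> of \<open>\<int>\<^sup>n\<close>, cutting \<open>X\<close> and \<open>Y\<close> along the right cosets of \<open>H\<close> transfers this
  to \<open>G\<close>: there is a finite \<open>Q \<subseteq> H\<close> such that \<open>X\<^sup>-\<^sup>1 Q Y\<close> has at least \<open>2 ^ n * min (card X) (card Y)\<close>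
  elements for all finite \<open>X\<close> and \<open>Y\<close> (\<open>card_inv_mult_ge_min\<close>). A Folner set \<open>F\<close> that is sufficiently
  invariant absorbs the thickening by \<open>Q\<close>. Hence, when the rank is infinite, for every constant \<open>D\<close>
  and all large \<open>n\<close> the product of the inverse of \<open>F n\<close> with an arbitrary finite \<open>Y\<close> has at least
  \<open>D * min (card (F n)) (card Y)\<close> elements (\<open>folner_eventually_card_inv_mult_ge\<close>).

  With \<open>Y = F n\<close> this contradicts the Tempel'man condition. With \<open>Y = F (Suc n)\<close> and the temperedness
  constant \<open>C\<close> it gives \<open>D * min (card (F n)) (card (F (Suc n))) \<le> C * card (F (Suc n))\<close>; for \<open>D > C\<close>
  the minimum must be \<open>card (F n)\<close>, so the ratio of successive sizes is eventually at least
  \<open>D / C\<close>, where \<open>D\<close> is arbitrary.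
\<close>

section \<open>A Prekopa--Leindler inequality on the integers\<close>

text \<open>The layer-cake formula. Only heights below \<open>1\<close> are integrated, which truncates the function at
  \<open>1\<close>: exact for functions bounded by \<open>1\<close>, and a lower bound in general.\<close>

lemma has_integral_card_superlevel:
  fixes f :: "'b \<Rightarrow> real"
  assumes "finite X" and nonneg: "\<And>x. x \<in> X \<Longrightarrow> 0 \<le> f x"
  shows "((\<lambda>t. real (card {x \<in> X. t \<le> f x})) has_integral (\<Sum>x\<in>X. min 1 (f x))) {0<..<1}"
proof -
  have "((\<lambda>t. if t \<le> f x then 1 else 0) has_integral min 1 (f x)) {0..1}" if "x \<in> X" for x
  proof -
    have "((\<lambda>t. if t \<in> {0..min 1 (f x)} then 1 else (0::real)) has_integral min 1 (f x)) {0..1}"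
      using has_integral_const_real[of "1::real" 0 "min 1 (f x)"] nonneg[OF that]
      by (intro has_integral_restrict[THEN iffD2]) auto
    then show ?thesis
      by (rule has_integral_eq[rotated]) auto
  qed
  then have "((\<lambda>t. \<Sum>x\<in>X. if t \<le> f x then 1 else (0::real)) has_integral (\<Sum>x\<in>X. min 1 (f x))) {0..1}"
    using \<open>finite X\<close> by (intro has_integral_sum) auto
  moreover have "(\<Sum>x\<in>X. if t \<le> f x then 1 else (0::real)) = real (card {x \<in> X. t \<le> f x})" for t
    using \<open>finite X\<close> by (simp add: sum.If_cases Int_def)
  ultimately show ?thesis
    by (simp add: has_integral_Icc_iff_Ioo)
qed

text \<open>The translate of \<open>A\<close> by \<open>Min B\<close> lies strictly to the left of the translate of \<open>B\<close> by
  \<open>Max A + 1\<close>. The additional shift by \<open>1\<close> gains the point that is missing in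
  \<open>card (A + B) \<ge> card A + card B - 1\<close>; without it no constant above \<open>1\<close> would
  hold for singletons.\<close>

lemma card_int_sumset_ge:
  fixes A B C :: "int set"
  assumes "finite A" "A \<noteq> {}" "finite B" "B \<noteq> {}" "finite C"
    and sums: "\<And>i j. i \<in> A \<Longrightarrow> j \<in> B \<Longrightarrow> i + j \<in> C \<and> i + j + 1 \<in> C"
  shows "card A + card B \<le> card C"
proof -
  let ?L = "(\<lambda>i. i + Min B) ` A" and ?R = "(\<lambda>j. Max A + j + 1) ` B"
  have "i + Min B < Max A + j + 1" if "i \<in> A" "j \<in> B" for i j
    using Max_ge[OF \<open>finite A\<close> \<open>i \<in> A\<close>] Min_le[OF \<open>finite B\<close> \<open>j \<in> B\<close>] by linarith
  then have "?L \<inter> ?R = {}" by fastforce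
  moreover have "?L \<union> ?R \<subseteq> C"
    using sums Max_in[OF assms(1,2)] Min_in[OF assms(3,4)] by auto
  moreover have "card ?L = card A" "card ?R = card B"
    by (auto intro!: card_image inj_onI)
  ultimately show ?thesis
    using assms by (metis card_Un_disjoint card_mono finite_imageI)
qed

text \<open>Scaling \<open>f\<close> and \<open>g\<close> to have maximum \<open>1\<close> makes their superlevel sets nonempty at every height
  below \<open>1\<close>, so that the sumset bound applies at each height; integrating over the height and
  the inequality of the means give the claim. The geometric mean in the hypothesis is what makes
  the inequality pass to products of groups.\<close>

lemma prekopa_leindler_int:
  fixes f g h :: "int \<Rightarrow> real"
  assumes fin: "finite X" "finite Y" "finite Z"
    and f: "\<And>i. i \<in> X \<Longrightarrow> 0 \<le> f i" and g: "\<And>j. j \<in> Y \<Longrightarrow> 0 \<le> g j"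
    and h: "\<And>k. k \<in> Z \<Longrightarrow> 0 \<le> h k"
    and fgh: "\<And>i j k. i \<in> X \<Longrightarrow> j \<in> Y \<Longrightarrow> k \<in> {i + j, i + j + 1} \<Longrightarrow>
                k \<in> Z \<and> sqrt (f i * g j) \<le> h k"
  shows "2 * sqrt (sum f X * sum g Y) \<le> sum h Z"
proof (cases "sum f X = 0 \<or> sum g Y = 0")
  case True
  then show ?thesis using h by (auto simp: sum_nonneg)
next
  case False
  then have ne: "X \<noteq> {}" "Y \<noteq> {}" by auto
  define M where "M = Max (f ` X)"
  define N where "N = Max (g ` Y)"
  have Mle: "f i \<le> M" if "i \<in> X" for i using that fin by (simp add: M_def)
  have Nle: "g j \<le> N" if "j \<in> Y" for j using that fin by (simp add: N_def)
  have "M \<in> f ` X" unfolding M_def using fin ne by (intro Max_in) auto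
  then obtain i0 where i0: "i0 \<in> X" "f i0 = M" by auto
  have "N \<in> g ` Y" unfolding N_def using fin ne by (intro Max_in) auto
  then obtain j0 where j0: "j0 \<in> Y" "g j0 = N" by auto
  have "M > 0"
  proof (rule ccontr)
    assume "\<not> M > 0"
    then have "f i = 0" if "i \<in> X" for i using f[OF that] Mle[OF that] by linarith
    with False show False by simp
  qed
  have "N > 0"
  proof (rule ccontr)
    assume "\<not> N > 0"
    then have "g j = 0" if "j \<in> Y" for j using g[OF that] Nle[OF that] by linarith
    with False show False by simp
  qed
  define P where "P = sqrt (M * N)"
  have "P > 0" using \<open>M > 0\<close> \<open>N > 0\<close> by (simp add: P_def)
  have levels: "card {i \<in> X. t \<le> f i / M} + card {j \<in> Y. t \<le> g j / N} \<le> card {k \<in> Z. t \<le> h k / P}"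
    if "t \<in> {0<..<1}" for t :: real
  proof (rule card_int_sumset_ge)
    show "{i \<in> X. t \<le> f i / M} \<noteq> {}" using i0 \<open>M > 0\<close> that by force
    show "{j \<in> Y. t \<le> g j / N} \<noteq> {}" using j0 \<open>N > 0\<close> that by force
  next
    fix i j
    assume i: "i \<in> {i \<in> X. t \<le> f i / M}" and j: "j \<in> {j \<in> Y. t \<le> g j / N}"
    have "t\<^sup>2 \<le> (f i / M) * (g j / N)"
      unfolding power2_eq_square using i j that by (intro mult_mono) auto
    then have "t \<le> sqrt ((f i / M) * (g j / N))"
      using that by (intro real_le_rsqrt) auto
    also have "\<dots> = sqrt (f i * g j) / P"
      by (simp add: P_def real_sqrt_divide[symmetric])
    finally have t: "t \<le> sqrt (f i * g j) / P" .
    have "k \<in> {k \<in> Z. t \<le> h k / P}" if "k \<in> {i + j, i + j + 1}" for k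
    proof -
      have "sqrt (f i * g j) / P \<le> h k / P"
        using fgh[OF _ _ that] i j \<open>P > 0\<close> by (intro divide_right_mono) auto
      then show ?thesis using t fgh[OF _ _ that] i j by auto
    qed
    then show "i + j \<in> {k \<in> Z. t \<le> h k / P} \<and> i + j + 1 \<in> {k \<in> Z. t \<le> h k / P}"
      by blast
  qed (use fin in auto)
  have "(\<Sum>i\<in>X. min 1 (f i / M)) + (\<Sum>j\<in>Y. min 1 (g j / N)) \<le> (\<Sum>k\<in>Z. min 1 (h k / P))"
  proof (rule has_integral_le)
    show "((\<lambda>t. real (card {i \<in> X. t \<le> f i / M}) + real (card {j \<in> Y. t \<le> g j / N}))
        has_integral (\<Sum>i\<in>X. min 1 (f i / M)) + (\<Sum>j\<in>Y. min 1 (g j / N))) {0<..<1}"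
      using fin f g \<open>M > 0\<close> \<open>N > 0\<close>
      by (intro has_integral_add has_integral_card_superlevel) auto
    show "((\<lambda>t. real (card {k \<in> Z. t \<le> h k / P})) has_integral
        (\<Sum>k\<in>Z. min 1 (h k / P))) {0<..<1}"
      using fin h \<open>P > 0\<close> by (intro has_integral_card_superlevel) auto
  qed (use levels in \<open>simp flip: of_nat_add\<close>)
  moreover have "(\<Sum>i\<in>X. min 1 (f i / M)) = sum f X / M"
    using Mle \<open>M > 0\<close> by (auto simp: sum_divide_distrib intro!: sum.cong min_absorb2)
  moreover have "(\<Sum>j\<in>Y. min 1 (g j / N)) = sum g Y / N"
    using Nle \<open>N > 0\<close> by (auto simp: sum_divide_distrib intro!: sum.cong min_absorb2)
  moreover have "(\<Sum>k\<in>Z. min 1 (h k / P)) \<le> sum h Z / P"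
    unfolding sum_divide_distrib by (rule sum_mono) simp
  ultimately have "sum f X / M + sum g Y / N \<le> sum h Z / P" by linarith
  moreover have "2 * sqrt ((sum f X / M) * (sum g Y / N)) \<le> sum f X / M + sum g Y / N"
    using arith_geo_mean_sqrt[of "sum f X / M" "sum g Y / N"] f g \<open>M > 0\<close> \<open>N > 0\<close>
    by (simp add: sum_nonneg)
  ultimately have "2 * sqrt ((sum f X / M) * (sum g Y / N)) \<le> sum h Z / P"
    by (rule order_trans[rotated])
  moreover have "sqrt ((sum f X / M) * (sum g Y / N)) = sqrt (sum f X * sum g Y) / P"
    by (simp add: P_def real_sqrt_divide[symmetric])
  ultimately have "2 * (sqrt (sum f X * sum g Y) / P) \<le> sum h Z / P" by simp
  then show ?thesis using \<open>P > 0\<close> by (simp add: field_simps)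
qed

section \<open>Expanding sets in free abelian groups\<close>

text \<open>A Brunn--Minkowski inequality for \<open>A + B\<close> thickened by a fixed finite set \<open>Q\<close>. For \<open>\<int>\<^sup>n\<close> with
  \<open>Q = {0, 1}\<^sup>n\<close> the constant is \<open>2 ^ n\<close>, as for convex bodies.\<close>

definition expanding :: "('b, 'c) monoid_scheme \<Rightarrow> 'b set \<Rightarrow> real \<Rightarrow> bool" where
  "expanding K Q c \<longleftrightarrow> finite Q \<and> Q \<subseteq> carrier K \<and>
     (\<forall>A B. finite A \<and> A \<subseteq> carrier K \<and> finite B \<and> B \<subseteq> carrier K \<longrightarrow>
        c * sqrt (real (card A) * real (card B)) \<le> real (card (A <#>\<^bsub>K\<^esub> Q <#>\<^bsub>K\<^esub> B)))"

lemma set_mult_memI: "x \<in> A \<Longrightarrow> y \<in> B \<Longrightarrow> x \<otimes>\<^bsub>K\<^esub> y \<in> A <#>\<^bsub>K\<^esub> B"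
  by (auto simp: set_mult_def)

lemma finite_set_mult: "finite A \<Longrightarrow> finite B \<Longrightarrow> finite (A <#>\<^bsub>K\<^esub> B)"
  by (auto simp: set_mult_def)

lemma card_eq_sum_slices:
  assumes "finite A"
  shows "card A = (\<Sum>i\<in>snd ` A. card {x. (x, i) \<in> A})"
proof -
  have "card A = (\<Sum>i\<in>snd ` A. card {p \<in> A. snd p = i})"
    using sum.image_gen[OF assms, of "\<lambda>_. 1::nat" snd] by simp
  also have "\<dots> = (\<Sum>i\<in>snd ` A. card {x. (x, i) \<in> A})"
  proof (rule sum.cong)
    fix i
    have "{p \<in> A. snd p = i} = (\<lambda>x. (x, i)) ` {x. (x, i) \<in> A}" by force
    then show "card {p \<in> A. snd p = i} = card {x. (x, i) \<in> A}"
      by (simp add: card_image inj_on_def)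
  qed simp
  finally show ?thesis .
qed

lemma finite_slice: "finite A \<Longrightarrow> finite {x. (x, i) \<in> A}"
  by (rule finite_subset[of _ "fst ` A"]) force+

text \<open>Tensorization: the slice of \<open>A Q B\<close> at height \<open>i + j\<close> or \<open>i + j + 1\<close> contains the product of the
  slices of \<open>A\<close> at \<open>i\<close> and of \<open>B\<close> at \<open>j\<close>, thickened by \<open>Q\<close>. So the inequality in \<open>K\<close> says that the
  slice sizes satisfy the hypothesis of the inequality on the integers, which contributes the
  factor \<open>2\<close>.\<close>

lemma expanding_DirProd_integer_group:
  assumes K: "expanding K Q c" and "c > 0"
  shows "expanding (K \<times>\<times> integer_group) (Q \<times> {0, 1}) (2 * c)"
proof -
  let ?L = "K \<times>\<times> integer_group"
  have "2 * c * sqrt (real (card A) * real (card B)) \<le> real (card (A <#>\<^bsub>?L\<^esub> (Q \<times> {0, 1}) <#>\<^bsub>?L\<^esub> B))"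
    if A: "finite A" "A \<subseteq> carrier ?L" and B: "finite B" "B \<subseteq> carrier ?L" for A B
  proof -
    define S where "S = A <#>\<^bsub>?L\<^esub> (Q \<times> {0, 1}) <#>\<^bsub>?L\<^esub> B"
    have finS: "finite S"
      using A B K by (auto simp: S_def expanding_def intro!: finite_set_mult)
    define slice where "slice = (\<lambda>(C :: ('a \<times> int) set) i. {x. (x, i) \<in> C})"
    have slice_sub: "slice A i <#>\<^bsub>K\<^esub> Q <#>\<^bsub>K\<^esub> slice B j \<subseteq> slice S k"
      if "k \<in> {i + j, i + j + 1}" for i j k
    proof
      fix z assume "z \<in> slice A i <#>\<^bsub>K\<^esub> Q <#>\<^bsub>K\<^esub> slice B j"
      then obtain x q y where xqy: "(x, i) \<in> A" "q \<in> Q" "(y, j) \<in> B" "z = x \<otimes>\<^bsub>K\<^esub> q \<otimes>\<^bsub>K\<^esub> y"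
        by (auto simp: set_mult_def slice_def)
      have "(x, i) \<otimes>\<^bsub>?L\<^esub> (q, k - i - j) \<otimes>\<^bsub>?L\<^esub> (y, j) \<in> S"
        unfolding S_def using xqy that by (intro set_mult_memI) auto
      then show "z \<in> slice S k" by (simp add: slice_def xqy)
    qed
    have slice_ge: "k \<in> snd ` S \<and>
        sqrt ((c * real (card (slice A i))) * (c * real (card (slice B j)))) \<le> real (card (slice S k))"
      if i: "i \<in> snd ` A" and j: "j \<in> snd ` B" and k: "k \<in> {i + j, i + j + 1}" for i j k
    proof -
      have fins: "finite (slice A i)" "finite (slice B j)" "finite (slice S k)"
        using finite_slice A B finS by (auto simp: slice_def)
      have "sqrt ((c * real (card (slice A i))) * (c * real (card (slice B j))))
          = c * sqrt (real (card (slice A i)) * real (card (slice B j)))"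
        using \<open>c > 0\<close> by (simp add: real_sqrt_mult)
      also have "\<dots> \<le> real (card (slice A i <#>\<^bsub>K\<^esub> Q <#>\<^bsub>K\<^esub> slice B j))"
      proof -
        have "slice A i \<subseteq> carrier K" "slice B j \<subseteq> carrier K"
          using A(2) B(2) by (auto simp: slice_def)
        then show ?thesis using K fins by (simp add: expanding_def)
      qed
      also have "\<dots> \<le> real (card (slice S k))"
        using card_mono[OF fins(3) slice_sub[OF k]] by simp
      finally have le: "sqrt ((c * real (card (slice A i))) * (c * real (card (slice B j))))
          \<le> real (card (slice S k))" .
      have "slice A i \<noteq> {}" "slice B j \<noteq> {}"
        using i j by (auto simp: slice_def)
      then have "card (slice A i) > 0" "card (slice B j) > 0"
        using fins by (simp_all add: card_gt_0_iff)
      then have "sqrt ((c * real (card (slice A i))) * (c * real (card (slice B j)))) > 0"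
        using \<open>c > 0\<close> by simp
      with le have "slice S k \<noteq> {}" by auto
      then have "k \<in> snd ` S" by (force simp: slice_def)
      with le show ?thesis by blast
    qed
    have "2 * c * sqrt (real (card A) * real (card B))
        = 2 * sqrt ((c * real (card A)) * (c * real (card B)))"
      using \<open>c > 0\<close> by (simp add: real_sqrt_mult)
    also have "\<dots> = 2 * sqrt ((\<Sum>i\<in>snd ` A. c * real (card (slice A i))) *
        (\<Sum>j\<in>snd ` B. c * real (card (slice B j))))"
      using card_eq_sum_slices[OF A(1)] card_eq_sum_slices[OF B(1)]
      by (simp add: slice_def sum_distrib_left)
    also have "\<dots> \<le> (\<Sum>k\<in>snd ` S. real (card (slice S k)))"
      using slice_ge A B finS \<open>c > 0\<close> by (intro prekopa_leindler_int) auto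
    also have "\<dots> = real (card S)"
      using card_eq_sum_slices[OF finS] by (simp add: slice_def)
    finally show ?thesis by (simp add: S_def)
  qed
  then show ?thesis
    using K by (auto simp: expanding_def)
qed

lemma (in group) expanding_iso:
  assumes "\<phi> \<in> iso G K" and exp: "expanding G Q c"
  shows "expanding K (\<phi> ` Q) c"
proof -
  have hom: "\<phi> \<in> hom G K" and inj: "inj_on \<phi> (carrier G)" and onto: "\<phi> ` carrier G = carrier K"
    using assms by (auto simp: iso_iff)
  have image_mult: "\<phi> ` (X <#> Y) = \<phi> ` X <#>\<^bsub>K\<^esub> \<phi> ` Y"
    if "X \<subseteq> carrier G" "Y \<subseteq> carrier G" for X Y
    using that by (force simp: set_mult_def hom_mult[OF hom] image_iff)
  have Q: "finite Q" "Q \<subseteq> carrier G" using exp by (auto simp: expanding_def)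
  have "c * sqrt (real (card A) * real (card B)) \<le> real (card (A <#>\<^bsub>K\<^esub> \<phi> ` Q <#>\<^bsub>K\<^esub> B))"
    if A: "finite A" "A \<subseteq> carrier K" and B: "finite B" "B \<subseteq> carrier K" for A B
  proof -
    obtain A' where A': "A' \<subseteq> carrier G" "finite A'" "A = \<phi> ` A'"
      using A onto by (metis finite_subset_image)
    obtain B' where B': "B' \<subseteq> carrier G" "finite B'" "B = \<phi> ` B'"
      using B onto by (metis finite_subset_image)
    have sub: "A' <#> Q <#> B' \<subseteq> carrier G" "A' <#> Q \<subseteq> carrier G"
      using A' B' Q by (simp_all add: set_mult_closed)
    have "card (A <#>\<^bsub>K\<^esub> \<phi> ` Q <#>\<^bsub>K\<^esub> B) = card (A' <#> Q <#> B')"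
      using A' B' Q sub
      by (simp add: image_mult[symmetric] card_image inj_on_subset[OF inj])
    moreover have "card A = card A'" "card B = card B'"
      using A' B' by (simp_all add: card_image inj_on_subset[OF inj])
    ultimately show ?thesis
      using exp A' B' by (simp add: expanding_def)
  qed
  then show ?thesis
    using Q image_mono[OF Q(2), of \<phi>] onto by (simp add: expanding_def)
qed

lemma group_int_power_group: "group (int_power_group n)"
  unfolding int_power_group_def by simp

text \<open>Induction along \<open>\<int>\<^sup>n\<^sup>+\<^sup>1 = \<int>\<^sup>n \<times> \<int>\<close>.\<close>

lemma ex_expanding_int_power_group: "\<exists>Q. expanding (int_power_group n) Q (2 ^ n)"
proof (induction n)
  case 0
  have "carrier (int_power_group 0) = {\<one>\<^bsub>int_power_group 0\<^esub>}"
    by (simp add: int_power_group_def restrict_def)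
  then have "expanding (int_power_group 0) {\<one>\<^bsub>int_power_group 0\<^esub>} 1"
    using monoid.l_one[OF group.is_monoid[OF group_int_power_group[of 0]]]
    by (auto simp: expanding_def set_mult_def subset_singleton_iff)
  then show ?case by auto
next
  case (Suc n)
  then obtain Q where Q: "expanding (int_power_group n) Q (2 ^ n)" by blast
  let ?K = "int_power_group n \<times>\<times> integer_group"
  define \<phi> where "\<phi> = (\<lambda>(f :: nat \<Rightarrow> int, k). f(n := k))"
  have "\<phi> \<in> iso ?K (int_power_group (Suc n))"
  proof (rule isoI)
    show "\<phi> \<in> hom ?K (int_power_group (Suc n))"
      by (auto simp: hom_def int_power_group_def \<phi>_def fun_eq_iff PiE_iff extensional_def
          split: if_splits; metis less_SucI)
    show "bij_betw \<phi> (carrier ?K) (carrier (int_power_group (Suc n)))"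
    proof (rule bij_betw_byWitness[where f' = "\<lambda>f. (f(n := undefined), f n)"])
      show "\<forall>p \<in> carrier ?K. ((\<phi> p)(n := undefined), \<phi> p n) = p"
        by (auto simp: int_power_group_def \<phi>_def fun_eq_iff PiE_iff extensional_def)
      show "\<forall>f \<in> carrier (int_power_group (Suc n)). \<phi> (f(n := undefined), f n) = f"
        by (simp add: \<phi>_def)
      show "\<phi> ` carrier ?K \<subseteq> carrier (int_power_group (Suc n))"
        by (auto simp: int_power_group_def \<phi>_def PiE_iff extensional_def split: if_splits;
            metis less_SucI)
      show "(\<lambda>f. (f(n := undefined), f n)) ` carrier (int_power_group (Suc n)) \<subseteq> carrier ?K"
        by (auto simp: int_power_group_def PiE_iff extensional_def split: if_splits;
            metis less_Suc_eq)
    qed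
  qed
  then have "expanding (int_power_group (Suc n)) (\<phi> ` (Q \<times> {0, 1})) (2 * 2 ^ n)"
    by (rule group.expanding_iso[OF DirProd_group[OF group_int_power_group group_integer_group]])
      (use expanding_DirProd_integer_group[OF Q] in auto)
  then show ?case by auto
qed

section \<open>From a subgroup to the whole group\<close>

lemma (in group) set_inv_closed: "A \<subseteq> carrier G \<Longrightarrow> set_inv A \<subseteq> carrier G"
  by (auto simp: SET_INV_def)

lemma finite_set_inv: "finite A \<Longrightarrow> finite (set_inv\<^bsub>K\<^esub> A)"
  by (simp add: SET_INV_def)

lemma (in group) card_set_inv: "A \<subseteq> carrier G \<Longrightarrow> card (set_inv A) = card A"
  by (simp add: SET_INV_def UNION_singleton_eq_range card_image inj_on_subset[OF inv_inj])

lemma (in group) set_inv_set_inv: "A \<subseteq> carrier G \<Longrightarrow> set_inv (set_inv A) = A"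
  by (force simp: SET_INV_def)

lemma (in group) set_inv_set_mult:
  assumes "A \<subseteq> carrier G" "B \<subseteq> carrier G"
  shows "set_inv (A <#> B) = set_inv B <#> set_inv A"
  using assms by (force simp: SET_INV_def set_mult_def inv_mult_group subset_iff)

lemma (in group) card_mult_swap:
  assumes "A \<subseteq> carrier G" "Q \<subseteq> carrier G" "B \<subseteq> carrier G"
  shows "card (set_inv B <#> set_inv Q <#> set_inv A) = card (A <#> Q <#> B)"
proof -
  have "set_inv (A <#> Q <#> B) = set_inv B <#> set_inv Q <#> set_inv A"
    using assms by (simp add: set_inv_set_mult set_mult_closed set_mult_assoc set_inv_closed)
  then show ?thesis
    using assms by (metis card_set_inv set_mult_closed)
qed

text \<open>Needed because inversion exchanges the two outer factors of \<open>X\<^sup>-\<^sup>1 Q Y\<close> but also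
  turns \<open>Q\<close> into its inverse.\<close>

lemma (in group) expanding_set_inv:
  assumes exp: "expanding G Q c"
  shows "expanding G (set_inv Q) c"
proof -
  have Q: "finite Q" "Q \<subseteq> carrier G" using exp by (auto simp: expanding_def)
  have "c * sqrt (real (card A) * real (card B)) \<le> real (card (A <#> set_inv Q <#> B))"
    if A: "finite A" "A \<subseteq> carrier G" and B: "finite B" "B \<subseteq> carrier G" for A B
  proof -
    have "c * sqrt (real (card (set_inv B)) * real (card (set_inv A)))
        \<le> real (card (set_inv B <#> Q <#> set_inv A))"
      using exp A B by (simp add: expanding_def finite_set_inv set_inv_closed)
    also have "card (set_inv B <#> Q <#> set_inv A) = card (A <#> set_inv Q <#> B)"
      using card_mult_swap[of A "set_inv Q" B] A B Q by (simp add: set_inv_closed set_inv_set_inv)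
    finally show ?thesis
      using A B by (simp add: card_set_inv mult.commute)
  qed
  then show ?thesis
    using Q by (simp add: expanding_def finite_set_inv set_inv_closed)
qed

lemma (in group) rcos_eq_iff:
  assumes "subgroup H G" "x \<in> carrier G" "y \<in> carrier G"
  shows "H #> x = H #> y \<longleftrightarrow> x \<otimes> inv y \<in> H"
  using assms repr_independence repr_independenceD subgroup.rcos_module[OF assms(1) group_axioms]
  by metis

text \<open>Let \<open>X\<^sub>C\<close> be the part of \<open>X\<close> in the right coset \<open>C\<close>, and \<open>Z\<close> the part of \<open>Y\<close> in the coset of \<open>y\<close>.
  The sets \<open>X\<^sub>C\<^sup>-\<^sup>1 Q Z\<close> lie in the disjoint translates \<open>C\<^sup>-\<^sup>1 y\<close>, so their sizes add up. Each is
  a translate of a product inside \<open>H\<close>, where the expansion inequality gives at least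
  \<open>c\<close> times the geometric mean of the sizes of \<open>X\<^sub>C\<close> and \<open>Z\<close>; as \<open>Z\<close> is at least as large as
  \<open>X\<^sub>C\<close>, this is at least \<open>c\<close> times the size of \<open>X\<^sub>C\<close>.\<close>

lemma (in group) card_coset_slices_le:
  assumes H: "subgroup H G" and exp: "expanding (G\<lparr>carrier := H\<rparr>) Q c" and "c \<ge> 0"
    and X: "finite X" "X \<subseteq> carrier G" and Y: "finite Y" "Y \<subseteq> carrier G" and y: "y \<in> Y"
    and le: "\<And>x. x \<in> X \<Longrightarrow>
      card {a \<in> X. H #> a = H #> x} \<le> card {b \<in> Y. H #> b = H #> y}"
  shows "c * real (card X) \<le> real (card (set_inv X <#> Q <#> Y))"
proof -
  interpret H: subgroup H G by fact
  define sl where "sl = (\<lambda>x. {a \<in> X. H #> a = H #> x})"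
  define Z where "Z = {b \<in> Y. H #> b = H #> y}"
  define T where "T = (\<lambda>x. set_inv (sl x) <#> Q <#> Z)"
  have Q: "finite Q" "Q \<subseteq> H" using exp by (auto simp: expanding_def)
  have QG: "Q \<subseteq> carrier G" using Q H.subset by blast
  have fin: "finite (sl x)" "finite Z" "finite (T x)" for x
    using X Y Q by (auto simp: sl_def Z_def T_def intro!: finite_set_mult finite_set_inv)
  have yG: "y \<in> carrier G" using y Y by blast
  have slice: "c * real (card (sl x)) \<le> real (card (T x))" if x: "x \<in> X" for x
  proof -
    have xG: "x \<in> carrier G" using x X by blast
    \<comment> \<open>Translating by \<open>x\<close> on the left and by the inverse of \<open>y\<close> on the right moves everything into \<open>H\<close>.\<close>
    define A where "A = (\<lambda>a. x \<otimes> inv a) ` sl x"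
    define B where "B = (\<lambda>b. b \<otimes> inv y) ` Z"
    have "A \<subseteq> H"
      using xG X H by (auto simp: A_def sl_def rcos_eq_iff[symmetric])
    have "B \<subseteq> H"
      using yG Y H by (auto simp: B_def Z_def rcos_eq_iff[symmetric])
    have "inj_on (\<lambda>a. x \<otimes> inv a) (sl x)"
      using xG X by (auto simp: inj_on_def sl_def subset_iff dest!: inj_onD[OF inv_inj])
    then have cardA: "card A = card (sl x)" by (simp add: A_def card_image)
    have "inj_on (\<lambda>b. b \<otimes> inv y) Z"
      using yG Y by (auto simp: inj_on_def Z_def subset_iff)
    then have cardB: "card B = card Z" by (simp add: B_def card_image)
    have "A <#> Q <#> B \<subseteq> (\<lambda>t. x \<otimes> t \<otimes> inv y) ` T x"
    proof
      fix u assume "u \<in> A <#> Q <#> B"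
      then obtain a q b where *: "a \<in> sl x" "q \<in> Q" "b \<in> Z"
        "u = (x \<otimes> inv a) \<otimes> q \<otimes> (b \<otimes> inv y)"
        by (auto simp: A_def B_def set_mult_def)
      have G: "a \<in> carrier G" "q \<in> carrier G" "b \<in> carrier G"
        using * X Y QG by (auto simp: sl_def Z_def)
      have "inv a \<otimes> q \<otimes> b \<in> T x"
        unfolding T_def using * by (intro set_mult_memI) (auto simp: SET_INV_def)
      moreover have "u = x \<otimes> (inv a \<otimes> q \<otimes> b) \<otimes> inv y"
        using G xG yG * by (simp add: m_assoc)
      ultimately show "u \<in> (\<lambda>t. x \<otimes> t \<otimes> inv y) ` T x" by blast
    qed
    then have "card (A <#> Q <#> B) \<le> card (T x)"
      using fin by (meson surj_card_le)
    moreover have "c * sqrt (real (card A) * real (card B)) \<le> real (card (A <#> Q <#> B))"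
      using exp \<open>A \<subseteq> H\<close> \<open>B \<subseteq> H\<close> fin by (simp add: expanding_def A_def B_def)
    moreover have "real (card (sl x)) \<le> sqrt (real (card A) * real (card B))"
      unfolding cardA cardB
      using le[OF x] by (intro real_le_rsqrt) (simp add: power2_eq_square sl_def Z_def mult_left_mono)
    ultimately show ?thesis
      using \<open>c \<ge> 0\<close> by (meson mult_left_mono of_nat_mono order_trans)
  qed
  have disj: "H #> x = H #> x'" if x: "x \<in> X" "x' \<in> X" and t: "t \<in> T x" "t \<in> T x'" for x x' t
  proof -
    have "\<exists>a h. a \<in> carrier G \<and> h \<in> H \<and> H #> a = H #> x \<and> t = inv a \<otimes> h \<otimes> y"
      if "t \<in> T x" for x
    proof -
      obtain a q b where *: "a \<in> sl x" "q \<in> Q" "b \<in> Z" "t = inv a \<otimes> q \<otimes> b"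
        using \<open>t \<in> T x\<close> by (auto simp: T_def set_mult_def SET_INV_def)
      have G: "a \<in> carrier G" "q \<in> carrier G" "b \<in> carrier G"
        using * X Y QG by (auto simp: sl_def Z_def)
      have "b \<otimes> inv y \<in> H" using * G yG H by (simp add: Z_def rcos_eq_iff)
      then have "q \<otimes> (b \<otimes> inv y) \<in> H" using * Q by blast
      moreover have "t = inv a \<otimes> (q \<otimes> (b \<otimes> inv y)) \<otimes> y"
        using G yG * by (simp add: m_assoc)
      ultimately show ?thesis using * G by (auto simp: sl_def)
    qed
    from this[OF t(1)] this[OF t(2)] obtain a h a' h' where
      a: "a \<in> carrier G" "h \<in> H" "H #> a = H #> x" "t = inv a \<otimes> h \<otimes> y" and
      a': "a' \<in> carrier G" "h' \<in> H" "H #> a' = H #> x'" "t = inv a' \<otimes> h' \<otimes> y"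
      by blast
    have hG: "h \<in> carrier G" "h' \<in> carrier G" using a a' by auto
    have "(inv a \<otimes> h) \<otimes> y = (inv a' \<otimes> h') \<otimes> y" using a(4) a'(4) by simp
    then have eq: "inv a' \<otimes> h' = inv a \<otimes> h"
      using a(1) a'(1) hG yG by simp
    have "a \<otimes> inv a' = a \<otimes> (inv a' \<otimes> h') \<otimes> inv h'"
      using a(1) a'(1) hG by (simp add: m_assoc)
    also have "\<dots> = h \<otimes> inv h'"
      unfolding eq using a(1) hG by (simp add: m_assoc[symmetric])
    finally have "a \<otimes> inv a' \<in> H" using a a' by simp
    then show ?thesis using a a' H by (metis rcos_eq_iff)
  qed
  define \<kappa> where "\<kappa> = (\<lambda>x. H #> x)"
  have "\<exists>R. R \<subseteq> X \<and> inj_on \<kappa> R \<and> \<kappa> ` X = \<kappa> ` R"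
    by (rule subset_image_inj[THEN iffD1]) (rule subset_refl)
  then obtain R where R: "R \<subseteq> X" "inj_on \<kappa> R" "\<kappa> ` X = \<kappa> ` R"
    by (elim exE conjE)
  have finR: "finite R" using R(1) X(1) by (rule finite_subset)
  have "X \<subseteq> (\<Union>x\<in>R. sl x)"
  proof
    fix a assume "a \<in> X"
    then obtain x where "x \<in> R" "\<kappa> a = \<kappa> x" using R(3) by blast
    with \<open>a \<in> X\<close> show "a \<in> (\<Union>x\<in>R. sl x)" by (auto simp: sl_def \<kappa>_def)
  qed
  then have "card X \<le> card (\<Union>x\<in>R. sl x)" using finR fin by (intro card_mono) auto
  also have "\<dots> \<le> (\<Sum>x\<in>R. card (sl x))" by (rule card_UN_le[OF finR])
  finally have "card X \<le> (\<Sum>x\<in>R. card (sl x))" .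
  then have "c * real (card X) \<le> c * (\<Sum>x\<in>R. real (card (sl x)))"
    using \<open>c \<ge> 0\<close> by (intro mult_left_mono) (simp_all flip: of_nat_sum)
  also have "\<dots> \<le> (\<Sum>x\<in>R. real (card (T x)))"
    unfolding sum_distrib_left using slice R by (intro sum_mono) auto
  also have "\<dots> = real (card (\<Union>x\<in>R. T x))"
  proof -
    have "T x \<inter> T x' = {}" if "x \<in> R" "x' \<in> R" "x \<noteq> x'" for x x'
      using disj[of x x'] that R(1) inj_onD[OF R(2), of x x'] unfolding \<kappa>_def by blast
    then show ?thesis
      using finR fin by (subst card_UN_disjoint) auto
  qed
  also have "\<dots> \<le> real (card (set_inv X <#> Q <#> Y))"
  proof -
    have "T x \<subseteq> set_inv X <#> Q <#> Y" for x
      unfolding T_def by (intro mono_set_mult) (auto simp: SET_INV_def sl_def Z_def)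
    then show ?thesis
      using X Y Q by (intro of_nat_mono card_mono UN_least finite_set_mult finite_set_inv) auto
  qed
  finally show ?thesis .
qed

text \<open>Of the largest coset slices of \<open>X\<close> and of \<open>Y\<close>, one is at least as large as the other. If it is the
  slice of \<open>Y\<close>, the previous lemma applies directly; otherwise it applies to the inverse
  \<open>Y\<^sup>-\<^sup>1 Q\<^sup>-\<^sup>1 X\<close>, with the roles of \<open>X\<close> and \<open>Y\<close> exchanged.\<close>

lemma (in group) card_inv_mult_ge_min:
  assumes H: "subgroup H G" and exp: "expanding (G\<lparr>carrier := H\<rparr>) Q c" and "c \<ge> 0"
    and X: "finite X" "X \<subseteq> carrier G" and Y: "finite Y" "Y \<subseteq> carrier G"
  shows "c * min (real (card X)) (real (card Y)) \<le> real (card (set_inv X <#> Q <#> Y))"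
proof (cases "X = {} \<or> Y = {}")
  case True
  then show ?thesis by auto
next
  case False
  interpret H: subgroup H G by fact
  have Q: "Q \<subseteq> H" using exp by (auto simp: expanding_def)
  define sl where "sl = (\<lambda>X x. {a \<in> X. H #> a = H #> x})"
  have "\<exists>x\<in>W. \<forall>a\<in>W. card (sl W a) \<le> card (sl W x)" if W: "finite W" "W \<noteq> {}" for W
  proof -
    have "Max ((\<lambda>x. card (sl W x)) ` W) \<in> (\<lambda>x. card (sl W x)) ` W"
      using W by (intro Max_in) auto
    then obtain x where "x \<in> W" "card (sl W x) = Max ((\<lambda>x. card (sl W x)) ` W)"
      by auto
    then show ?thesis using W by (metis Max_ge finite_imageI imageI)
  qed
  then obtain x y where x: "x \<in> X" "\<And>a. a \<in> X \<Longrightarrow> card (sl X a) \<le> card (sl X x)"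
    and y: "y \<in> Y" "\<And>a. a \<in> Y \<Longrightarrow> card (sl Y a) \<le> card (sl Y y)"
    using X Y False by meson
  show ?thesis
  proof (cases "card (sl X x) \<le> card (sl Y y)")
    case True
    then have "card (sl X a) \<le> card (sl Y y)" if "a \<in> X" for a
      using x(2)[OF that] by linarith
    then have "c * real (card X) \<le> real (card (set_inv X <#> Q <#> Y))"
      unfolding sl_def by (rule card_coset_slices_le[OF H exp \<open>c \<ge> 0\<close> X Y y(1)])
    moreover have "c * min (real (card X)) (real (card Y)) \<le> c * real (card X)"
      using \<open>c \<ge> 0\<close> by (simp add: mult_left_mono)
    ultimately show ?thesis by linarith
  next
    case False
    have "set_inv\<^bsub>G\<lparr>carrier := H\<rparr>\<^esub> Q = set_inv Q"
      unfolding SET_INV_def using Q m_inv_consistent[OF H] by (intro SUP_cong) (auto simp: subset_iff)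
    then have exp': "expanding (G\<lparr>carrier := H\<rparr>) (set_inv Q) c"
      using group.expanding_set_inv[OF H.subgroup_is_group[OF group_axioms] exp] by simp
    have "card (sl Y b) \<le> card (sl X x)" if "b \<in> Y" for b
      using False y(2)[OF that] by linarith
    then have "c * real (card Y) \<le> real (card (set_inv Y <#> set_inv Q <#> X))"
      unfolding sl_def by (rule card_coset_slices_le[OF H exp' \<open>c \<ge> 0\<close> Y X x(1)])
    also have "card (set_inv Y <#> set_inv Q <#> X) = card (set_inv X <#> Q <#> Y)"
      using card_mult_swap[of "set_inv X" Q Y] X Y Q H.subset
      by (simp add: set_inv_closed set_inv_set_inv subset_trans)
    finally have "c * real (card Y) \<le> real (card (set_inv X <#> Q <#> Y))" .
    moreover have "c * min (real (card X)) (real (card Y)) \<le> c * real (card Y)"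
      using \<open>c \<ge> 0\<close> by (simp add: mult_left_mono)
    ultimately show ?thesis by linarith
  qed
qed

section \<open>Folner sequences in groups of infinite abelian rank\<close>

lemma ex_subgroup_of_rank:
  assumes "abelian_rank G = \<infinity>"
  obtains n H where "r \<le> n" "subgroup H G" "G\<lparr>carrier := H\<rparr> \<cong> int_power_group n"
proof -
  have "enat r < abelian_rank G" using assms by simp
  then obtain n H where "enat r < enat n" "subgroup H G" "G\<lparr>carrier := H\<rparr> \<cong> int_power_group n"
    unfolding abelian_rank_def less_Sup_iff by blast
  then show ?thesis using that[of n H] by simp
qed

lemma (in group) ex_inv_mult_ge_min:
  assumes "abelian_rank G = \<infinity>"
  obtains Q where "finite Q" "Q \<subseteq> carrier G"
    "\<And>X Y. \<lbrakk>finite X; X \<subseteq> carrier G; finite Y; Y \<subseteq> carrier G\<rbrakk> \<Longrightarrow>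
       D * min (real (card X)) (real (card Y)) \<le> real (card (set_inv X <#> Q <#> Y))"
proof -
  obtain r where r: "D < 2 ^ r" using real_arch_pow[of 2 D] by auto
  obtain n H where nH: "r \<le> n" "subgroup H G" "G\<lparr>carrier := H\<rparr> \<cong> int_power_group n"
    using ex_subgroup_of_rank[OF assms] by metis
  obtain Q' where Q': "expanding (int_power_group n) Q' (2 ^ n)"
    using ex_expanding_int_power_group by blast
  have "group (G\<lparr>carrier := H\<rparr>)"
    using nH(2) by (rule subgroup.subgroup_is_group) (rule group_axioms)
  then have "int_power_group n \<cong> G\<lparr>carrier := H\<rparr>"
    using nH(3) group.iso_sym by blast
  then obtain \<phi> where \<phi>: "\<phi> \<in> iso (int_power_group n) (G\<lparr>carrier := H\<rparr>)"
    by (auto simp: is_iso_def)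
  define Q where "Q = \<phi> ` Q'"
  have Q: "expanding (G\<lparr>carrier := H\<rparr>) Q (2 ^ n)"
    unfolding Q_def by (rule group.expanding_iso[OF group_int_power_group \<phi> Q'])
  have "D \<le> 2 ^ n"
    using r nH(1) power_increasing[of r n "2::real"] by linarith
  show ?thesis
  proof
    show "finite Q" "Q \<subseteq> carrier G"
      using Q subgroup.subset[OF nH(2)] by (auto simp: expanding_def)
    fix X Y assume XY: "finite X" "X \<subseteq> carrier G" "finite Y" "Y \<subseteq> carrier G"
    have "D * min (real (card X)) (real (card Y)) \<le> 2 ^ n * min (real (card X)) (real (card Y))"
      using \<open>D \<le> 2 ^ n\<close> by (intro mult_right_mono) auto
    also have "\<dots> \<le> real (card (set_inv X <#> Q <#> Y))"
      using card_inv_mult_ge_min[OF nH(2) Q _ XY] by simp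
    finally show "D * min (real (card X)) (real (card Y)) \<le> real (card (set_inv X <#> Q <#> Y))" .
  qed
qed

text \<open>Each \<open>q \<in> Q\<close> removes only the points of \<open>F n\<close> outside \<open>q F n\<close>, a fraction of \<open>F n\<close> that tends to
  \<open>0\<close>.\<close>

lemma (in group) folner_eventually_card_core:
  assumes F: "folner_sequence G F" and Q: "finite Q" "Q \<subseteq> carrier G"
  shows "\<forall>\<^sub>F n in sequentially.
    real (card (F n)) \<le> 2 * real (card {f \<in> F n. \<forall>q\<in>Q. inv q \<otimes> f \<in> F n})"
proof -
  define \<rho> where "\<rho> = (\<lambda>q n. real (card ((q <# F n) \<inter> F n)) / real (card (F n)))"
  have "\<rho> q \<longlonglongrightarrow> 1" if "q \<in> Q" for q
    using F Q(2) that unfolding folner_sequence_def \<rho>_def by blast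
  then have "(\<lambda>n. \<Sum>q\<in>Q. 1 - \<rho> q n) \<longlonglongrightarrow> (\<Sum>q\<in>Q. 1 - 1)"
    by (intro tendsto_sum tendsto_diff tendsto_const)
  then have "\<forall>\<^sub>F n in sequentially. (\<Sum>q\<in>Q. 1 - \<rho> q n) < 1 / 2"
    by (intro order_tendstoD(2)[where y = 0]) auto
  then show ?thesis
    using eventually_ge_at_top[of 1]
  proof eventually_elim
    case (elim n)
    have Fn: "finite (F n)" "F n \<subseteq> carrier G" "card (F n) > 0"
      using F elim by (auto simp: folner_sequence_def card_gt_0_iff)
    define core where "core = {f \<in> F n. \<forall>q\<in>Q. inv q \<otimes> f \<in> F n}"
    have "F n - core \<subseteq> (\<Union>q\<in>Q. F n - (q <# F n))"
    proof
      fix f assume "f \<in> F n - core"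
      then obtain q where q: "q \<in> Q" "inv q \<otimes> f \<notin> F n" "f \<in> F n" by (auto simp: core_def)
      have "f \<notin> q <# F n"
      proof
        assume "f \<in> q <# F n"
        then obtain h where h: "h \<in> F n" "f = q \<otimes> h" by (auto simp: l_coset_def)
        then have "inv q \<otimes> f = h"
          using q Q Fn by (metis inv_solve_left m_closed subsetD)
        then show False using q h by simp
      qed
      then show "f \<in> (\<Union>q\<in>Q. F n - (q <# F n))" using q by blast
    qed
    then have "card (F n - core) \<le> card (\<Union>q\<in>Q. F n - (q <# F n))"
      using Fn Q by (intro card_mono) auto
    also have "\<dots> \<le> (\<Sum>q\<in>Q. card (F n - (q <# F n)))"
      by (rule card_UN_le[OF Q(1)])
    finally have "real (card (F n - core)) \<le> (\<Sum>q\<in>Q. real (card (F n - (q <# F n))))"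
      by (simp flip: of_nat_sum)
    also have "\<dots> = (\<Sum>q\<in>Q. real (card (F n)) * (1 - \<rho> q n))"
    proof (rule sum.cong)
      fix q
      have "card (F n - (q <# F n)) + card ((q <# F n) \<inter> F n) = card (F n)"
        using card_Diff_subset_Int[of "F n" "q <# F n"] card_mono[of "F n" "F n \<inter> (q <# F n)"] Fn
        by (simp add: Int_commute)
      then have "real (card (F n - (q <# F n))) + real (card ((q <# F n) \<inter> F n)) = real (card (F n))"
        by (simp flip: of_nat_add)
      then show "real (card (F n - (q <# F n))) = real (card (F n)) * (1 - \<rho> q n)"
        using Fn by (simp add: \<rho>_def right_diff_distrib)
    qed simp
    also have "\<dots> \<le> real (card (F n)) * (1 / 2)"
      unfolding sum_distrib_left[symmetric] using elim by (intro mult_left_mono) auto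
    finally have "real (card (F n - core)) \<le> real (card (F n)) / 2" by simp
    moreover have "card (F n - core) + card core = card (F n)"
      using Fn by (subst card_Un_disjoint[symmetric]) (auto simp: core_def intro!: arg_cong[of _ _ card])
    then have "real (card (F n - core)) + real (card core) = real (card (F n))"
      by (simp flip: of_nat_add)
    ultimately show ?case unfolding core_def[symmetric] by linarith
  qed
qed

text \<open>The thickening by \<open>Q\<close> costs nothing for a Folner set: the core \<open>E\<close> of \<open>F n\<close> satisfies
  \<open>Q\<^sup>-\<^sup>1 E \<subseteq> F n\<close>, hence \<open>E\<^sup>-\<^sup>1 Q Y \<subseteq> (F n)\<^sup>-\<^sup>1 Y\<close>. Passing from \<open>F n\<close> to its core loses a factor
  of at most \<open>2\<close>, which is absorbed by taking \<open>Q\<close> for the constant \<open>2 * D\<close>.\<close>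

lemma (in group) folner_eventually_card_inv_mult_ge:
  assumes rank: "abelian_rank G = \<infinity>" and F: "folner_sequence G F" and "D \<ge> 0"
  shows "\<forall>\<^sub>F n in sequentially. \<forall>Y. finite Y \<longrightarrow> Y \<subseteq> carrier G \<longrightarrow>
    D * min (real (card (F n))) (real (card Y)) \<le> real (card (set_inv (F n) <#> Y))"
proof -
  obtain Q where Q: "finite Q" "Q \<subseteq> carrier G" and
    ge: "\<And>X Y. \<lbrakk>finite X; X \<subseteq> carrier G; finite Y; Y \<subseteq> carrier G\<rbrakk> \<Longrightarrow>
       2 * D * min (real (card X)) (real (card Y)) \<le> real (card (set_inv X <#> Q <#> Y))"
    using ex_inv_mult_ge_min[OF rank] by metis
  from folner_eventually_card_core[OF F Q] eventually_ge_at_top[of 1]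
  show ?thesis
  proof eventually_elim
    case (elim n)
    define core where "core = {f \<in> F n. \<forall>q\<in>Q. inv q \<otimes> f \<in> F n}"
    have Fn: "finite (F n)" "F n \<subseteq> carrier G"
      using F elim by (auto simp: folner_sequence_def)
    have core: "finite core" "core \<subseteq> carrier G" using Fn by (auto simp: core_def)
    show ?case
    proof (intro allI impI)
      fix Y assume Y: "finite Y" "Y \<subseteq> carrier G"
      have "min (real (card (F n))) (real (card Y)) \<le> 2 * min (real (card core)) (real (card Y))"
        using elim by (simp add: core_def)
      then have "D * min (real (card (F n))) (real (card Y))
          \<le> D * (2 * min (real (card core)) (real (card Y)))"
        using \<open>D \<ge> 0\<close> by (rule mult_left_mono)
      also have "\<dots> = 2 * D * min (real (card core)) (real (card Y))" by simp
      also have "\<dots> \<le> real (card (set_inv core <#> Q <#> Y))"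
        by (rule ge[OF core Y])
      also have "\<dots> \<le> real (card (set_inv (F n) <#> Y))"
      proof -
        have "set_inv core <#> Q \<subseteq> set_inv (F n)"
        proof
          fix u assume "u \<in> set_inv core <#> Q"
          then obtain f q where fq: "f \<in> core" "q \<in> Q" "u = inv f \<otimes> q"
            by (auto simp: set_mult_def SET_INV_def)
          then have "u = inv (inv q \<otimes> f)"
            using core Q by (simp add: inv_mult_group subset_iff)
          then show "u \<in> set_inv (F n)"
            using fq by (auto simp: core_def SET_INV_def)
        qed
        then show ?thesis
          using Fn Y by (intro of_nat_mono card_mono mono_set_mult finite_set_mult finite_set_inv) auto
      qed
      finally show "D * min (real (card (F n))) (real (card Y)) \<le> real (card (set_inv (F n) <#> Y))" .
    qed
  qed
qed

lemma super_exponential_if_ratio: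
  fixes F :: "nat \<Rightarrow> 'b set"
  assumes ratio: "\<And>c. c > 1 \<Longrightarrow>
      \<forall>\<^sub>F n in sequentially. 0 < card (F n) \<and> c * real (card (F n)) \<le> real (card (F (Suc n)))"
  shows "grows_super_exponentially F"
  unfolding grows_super_exponentially_def
proof (intro allI impI)
  fix c :: real assume "c > 1"
  then obtain N where pos: "0 < card (F N)" and
    N: "\<And>n. n \<ge> N \<Longrightarrow> 2 * c * real (card (F n)) \<le> real (card (F (Suc n)))"
    using ratio[of "2 * c"] by (auto simp: eventually_sequentially)
  have growth: "(2 * c) ^ k \<le> real (card (F (N + k)))" for k
  proof (induction k)
    case 0
    then show ?case using pos by simp
  next
    case (Suc k)
    have "(2 * c) ^ Suc k \<le> 2 * c * real (card (F (N + k)))"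
      using Suc \<open>c > 1\<close> by (simp add: mult_left_mono)
    also have "\<dots> \<le> real (card (F (N + Suc k)))" using N[of "N + k"] by simp
    finally show ?case .
  qed
  \<comment> \<open>The factor \<open>2 ^ k\<close> gained over \<open>c ^ k\<close> makes up for the first \<open>N\<close> terms.\<close>
  obtain K where K: "c ^ N < 2 ^ K" using real_arch_pow[of 2 "c ^ N"] by auto
  have "c ^ n \<le> real (card (F n))" if "n \<ge> N + K" for n
  proof -
    define k where "k = n - N"
    have k: "n = N + k" "K \<le> k" using that by (auto simp: k_def)
    have "c ^ N \<le> 2 ^ k"
      using K power_increasing[OF k(2), of "2::real"] by linarith
    then have "c ^ n \<le> 2 ^ k * c ^ k"
      using \<open>c > 1\<close> by (simp add: k(1) power_add)
    also have "\<dots> \<le> real (card (F n))" using growth[of k] by (simp add: k(1) power_mult_distrib)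
    finally show ?thesis .
  qed
  then show "\<forall>\<^sub>F n in sequentially. c ^ n \<le> real (card (F n))"
    by (auto simp: eventually_sequentially)
qed

theorem mainTheorem2:
  fixes G :: "('a, 'b) monoid_scheme"
  assumes "group G"
    and "countable (carrier G)"
    and "abelian_rank G = \<infinity>"
  shows "(\<nexists>F. tempelman_sequence G F) \<and>
         (\<forall>F. tempered_sequence G F \<longrightarrow> grows_super_exponentially F)"
proof (intro conjI allI impI notI)
  interpret group G by fact
  assume "\<exists>F. tempelman_sequence G F"
  then obtain F C where F: "folner_sequence G F" and
    C: "\<And>n. n \<ge> 1 \<Longrightarrow> real (card (set_inv\<^bsub>G\<^esub> (F n) <#>\<^bsub>G\<^esub> F n)) \<le> C * real (card (F n))"
    unfolding tempelman_sequence_def by blast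
  have "\<forall>\<^sub>F n in sequentially. n \<ge> 1 \<and> (\<forall>Y. finite Y \<longrightarrow> Y \<subseteq> carrier G \<longrightarrow>
      (\<bar>C\<bar> + 1) * min (real (card (F n))) (real (card Y)) \<le> real (card (set_inv\<^bsub>G\<^esub> (F n) <#>\<^bsub>G\<^esub> Y)))"
    by (intro eventually_conj eventually_ge_at_top
        folner_eventually_card_inv_mult_ge[OF assms(3) F]) simp
  then obtain n where n: "n \<ge> 1" and ge: "\<And>Y. finite Y \<Longrightarrow> Y \<subseteq> carrier G \<Longrightarrow>
      (\<bar>C\<bar> + 1) * min (real (card (F n))) (real (card Y)) \<le> real (card (set_inv\<^bsub>G\<^esub> (F n) <#>\<^bsub>G\<^esub> Y))"
    by (auto simp: eventually_sequentially)
  have Fn: "finite (F n)" "F n \<subseteq> carrier G" "card (F n) > 0"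
    using F n by (auto simp: folner_sequence_def card_gt_0_iff)
  have "(\<bar>C\<bar> + 1) * real (card (F n)) \<le> C * real (card (F n))"
    using ge[OF Fn(1,2)] C[OF n] by simp
  then show False using Fn(3) by simp
next
  interpret group G by fact
  fix F assume "tempered_sequence G F"
  then obtain C0 where F: "folner_sequence G F" and
    C0: "\<And>n. n \<ge> 1 \<Longrightarrow> real (card ((\<Union>i\<in>{1..<n}. set_inv\<^bsub>G\<^esub> (F i)) <#>\<^bsub>G\<^esub> F n)) \<le> C0 * real (card (F n))"
    unfolding tempered_sequence_def by blast
  have F': "finite (F n)" "F n \<subseteq> carrier G" "card (F n) > 0" if "n \<ge> 1" for n
    using F that by (auto simp: folner_sequence_def card_gt_0_iff)
  define C where "C = max C0 1"
  have C: "real (card (set_inv\<^bsub>G\<^esub> (F n) <#>\<^bsub>G\<^esub> F (Suc n))) \<le> C * real (card (F (Suc n)))"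
    if "n \<ge> 1" for n
  proof -
    have "card (set_inv\<^bsub>G\<^esub> (F n) <#>\<^bsub>G\<^esub> F (Suc n))
        \<le> card ((\<Union>i\<in>{1..<Suc n}. set_inv\<^bsub>G\<^esub> (F i)) <#>\<^bsub>G\<^esub> F (Suc n))"
      using that F' by (intro card_mono mono_set_mult finite_set_mult finite_UN_I finite_set_inv) auto
    also have "real \<dots> \<le> C0 * real (card (F (Suc n)))" using C0[of "Suc n"] by simp
    also have "\<dots> \<le> C * real (card (F (Suc n)))"
      by (intro mult_right_mono) (auto simp: C_def)
    finally show ?thesis by simp
  qed
  show "grows_super_exponentially F"
  proof (rule super_exponential_if_ratio)
    fix c :: real assume "c > 1"
    have "C \<ge> 1" by (simp add: C_def)
    have "\<forall>\<^sub>F n in sequentially. \<forall>Y. finite Y \<longrightarrow> Y \<subseteq> carrier G \<longrightarrow>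
      (c * C) * min (real (card (F n))) (real (card Y)) \<le> real (card (set_inv\<^bsub>G\<^esub> (F n) <#>\<^bsub>G\<^esub> Y))"
      using \<open>c > 1\<close> \<open>C \<ge> 1\<close> by (intro folner_eventually_card_inv_mult_ge[OF assms(3) F]) simp
    then show "\<forall>\<^sub>F n in sequentially. 0 < card (F n) \<and> c * real (card (F n)) \<le> real (card (F (Suc n)))"
      using eventually_ge_at_top[of 1]
    proof eventually_elim
      case (elim n)
      let ?a = "real (card (F n))" and ?b = "real (card (F (Suc n)))"
      have "(c * C) * min ?a ?b \<le> real (card (set_inv\<^bsub>G\<^esub> (F n) <#>\<^bsub>G\<^esub> F (Suc n)))"
        using elim(1) F'(1,2)[of "Suc n"] by simp
      also have "\<dots> \<le> C * ?b" by (rule C[OF elim(2)])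
      finally have "C * (c * min ?a ?b) \<le> C * ?b" by (simp only: mult_ac)
      then have le: "c * min ?a ?b \<le> ?b"
        using \<open>C \<ge> 1\<close> by simp
      \<comment> \<open>Otherwise the minimum is \<open>?b\<close>, which \<open>c > 1\<close> excludes.\<close>
      moreover have "\<not> ?b < ?a"
      proof
        assume "?b < ?a"
        then have "c * ?b \<le> 1 * ?b" using le by simp
        then show False using F'(3)[of "Suc n"] \<open>c > 1\<close> by (simp del: mult_1)
      qed
      ultimately show ?case using F'(3)[OF elim(2)] by (simp add: min_def split: if_splits)
    qed
  qed
qed

end
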